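(* Let $0<T_{\min}\le T_{\max}<\infty$, let $A(\tau)\in\mathbb{R}^{n\times n}$ (Metzler), $E_c(\tau)\in\mathbb{R}^{n\times p_c}$, $C_c(\tau)\in\mathbb{R}^{q_c\times n}$, $F_c(\tau)\in\mathbb{R}^{q_c\times p_c}$ (nonnegative) be matrix-valued functions of the timer variable $\tau$, and let $J\in\mathbb{R}^{n\times n}$, $E_d\in\mathbb{R}^{n\times p_d}$, $C_d\in\mathbb{R}^{q_d\times n}$, $F_d\in\mathbb{R}^{q_d\times p_d}$ be nonnegative constant matrices. Then the following statements are equivalent: (a) There exist a continuously differentiable vector-valued function $\zeta:\mathbb{R}\to\mathbb{R}^n$, $\zeta(0)>0$, and a scalar $\gamma$ such that $$-\dot\zeta(\tau)+A(\tau)\zeta(\tau)+E_c(\tau)\mathbf 1<0,\quad C_c(\tau)\zeta(\tau)+F_c(\tau)\mathbf 1-\gamma\mathbf 1<0,\quad J\zeta(\theta)-\zeta(0)+E_d\mathbf 1<0,\quad C_d\zeta(\theta)+F_d\mathbf 1-\gamma\mathbf 1<0$$ hold for all $\tau\in[0,T_{\max}]$ and all $\theta\in[T_{\min},T_{\max}]$. (b) There exist sufficiently large degrees $d$ and $r$, a polynomial vector $\zeta:\mathbb{R}\to\mathbb{R}^n$ of degree $d$, polynomial vectors $\psi_1,\psi_2:\mathbb{R}\to\mathbb{R}^n$, $\psi_3:\mathbb{R}\to\mathbb{R}^{q_c}$, $\psi_4:\mathbb{R}\to\mathbb{R}^{q_d}$ of degree $2r$, a scalar $\gamma\ge0$ and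 a scalar $\epsilon>0$ such that, with $f(\tau):=\tau(T_{\max}-\tau)$ and $g(\theta):=(\theta-T_{\min})(T_{\max}-\theta)$: (b1) $\psi_1(\tau),\psi_2(\tau),\psi_3(\tau)$ and $\psi_4(\tau)$ are CSOS; (b2) $\zeta(0)-\epsilon\mathbf 1\ge0$ (or is CSOS); (b3) $\dot\zeta(\tau)-A(\tau)\zeta(\tau)-E_c(\tau)\mathbf 1-f(\tau)\psi_1(\tau)-\epsilon\mathbf 1$ is CSOS; (b4) $-J\zeta(\theta)+\zeta(0)-E_d\mathbf 1-g(\theta)\psi_2(\theta)-\epsilon\mathbf 1$ is CSOS; (b5) $-C_c(\tau)\zeta(\tau)-F_c(\tau)\mathbf 1+\gamma\mathbf 1-f(\tau)\psi_3(\tau)-\epsilon\mathbf 1$ is CSOS; (b6) $-C_d\zeta(\theta)-F_d\mathbf 1+\gamma\mathbf 1-g(\theta)\psi_4(\theta)-\epsilon\mathbf 1$ is CSOS.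
   Context: Inequalities are componentwise and $\mathbf 1$ is the all-ones vector. A matrix is Metzler if its off-diagonal entries are nonnegative. A polynomial is a sum of squares (SOS) if it can be written as $\sum_iq_i(x)^2$ with polynomials $q_i$; a polynomial vector or matrix is componentwise sum-of-squares (CSOS) if each of its entries is an SOS polynomial. The matrices are those of a timer-dependent internally positive impulsive system with zero control input: between impulses $\partial_\tau x(t_k+\tau)=A(\tau)x(t_k+\tau)+E_c(\tau)w_c(t_k+\tau)$, $z_c(t_k+\tau)=C_c(\tau)x(t_k+\tau)+F_c(\tau)w_c(t_k+\tau)$ for $\tau\in(0,t_{k+1}-t_k]$, and at impulses $x(t_k^+)=Jx(t_k)+E_dw_d(k)$, $z_d(k)=C_dx(t_k)+F_dw_d(k)$, with dwell-times $t_{k+1}-t_k\in[T_{\min},T_{\max}]$.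
   Formalization: The matrices A, E_c, C_c, F_c are assumed to be polynomial in τ; otherwise the equivalence fails, e.g. n=1, A(τ)=−3−e^{−τ}, all other matrices zero: (a) holds with ζ=1, γ=1, but Aζ is not a polynomial for any polynomial ζ≠0, so (b3) fails. *)

theory Defs
  imports "HOL-Analysis.Analysis" "HOL-Computational_Algebra.Polynomial"
begin

(* The order relations of the library on real ^ 'n and real ^ 'n ^ 'm: (\<le>) is entrywise, but
   x < y only means x \<le> y and x \<noteq> y. The strict entrywise inequality is therefore defined here.
   The constant 1 :: real ^ 'n is the all-ones vector. *)
definition vec_less :: "real ^ 'n \<Rightarrow> real ^ 'n \<Rightarrow> bool" (infix "<\<^sub>v" 50)
  where "x <\<^sub>v y \<longleftrightarrow> (\<forall>i. x $ i < y $ i)"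

definition metzler :: "real ^ 'n ^ 'n \<Rightarrow> bool"
  where "metzler M \<longleftrightarrow> (\<forall>i j. i \<noteq> j \<longrightarrow> 0 \<le> M $ i $ j)"

definition sos :: "(real \<Rightarrow> real) \<Rightarrow> bool"
  where "sos p \<longleftrightarrow> (\<exists>qs :: real poly list. \<forall>x. p x = (\<Sum>q\<leftarrow>qs. (poly q x)\<^sup>2))"

definition csos :: "(real \<Rightarrow> real ^ 'n) \<Rightarrow> bool"
  where "csos v \<longleftrightarrow> (\<forall>i. sos (\<lambda>x. v x $ i))"

definition poly_vec :: "real poly ^ 'n \<Rightarrow> real \<Rightarrow> real ^ 'n"
  where "poly_vec v x = (\<chi> i. poly (v $ i) x)"

definition degree_vec :: "real poly ^ 'n \<Rightarrow> nat"
  where "degree_vec v = Max (range (\<lambda>i. degree (v $ i)))"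

end

theory Submission
  imports Defs
begin

text \<open>
  Statement (b) implies (a) pointwise: on \<open>[0, Tmax]\<close> the multiplier \<open>\<tau> * (Tmax - \<tau>)\<close> is nonnegative,
  and so is \<open>(\<theta> - Tmin) * (Tmax - \<theta>)\<close> on \<open>[Tmin, Tmax]\<close>; sums of squares are nonnegative, and the
  summand \<open>\<epsilon>\<close> makes the resulting inequalities strict. The polynomial \<open>\<zeta>\<close> of (b) is thus itself a
  solution of (a).

  The converse consists of three steps.

  Slack. All expressions in (a) are continuous and their domains are compact, so the strict
  inequalities hold with a common margin (\<open>uniform_slack\<close>). Raising \<open>\<gamma>\<close> to a nonnegative value
  preserves them.

  Approximation. By Weierstrass, the derivative of \<open>\<zeta>\<close> is approximated uniformly on \<open>[0, Tmax]\<close> by a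
  polynomial; an antiderivative with the initial value \<open>\<zeta> 0\<close> then approximates \<open>\<zeta>\<close> as well
  (\<open>poly_vec_C1_approximation\<close>). Every expression in (a) is affine in \<open>\<zeta>\<close> and its derivative,
  with coefficients bounded on the interval, so a sufficiently good approximation keeps part of the
  margin. From here on, each constraint asks a vector of polynomials to exceed \<open>\<epsilon>\<close> on an interval.

  Certificates. In one variable, a polynomial that is nonnegative on the whole line is a sum of
  squares (\<open>nonneg_poly_sos\<close>). For a polynomial \<open>p\<close> that is positive on \<open>[a, b]\<close> it therefore suffices
  to find \<open>\<psi>\<close> with \<open>p - (x - a) * (b - x) * \<psi>\<close> nonnegative everywhere, and a single even power
  \<open>\<psi> = c * ((x - m) / s) ^ (2 * r)\<close> around the midpoint \<open>m\<close> does this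
  (\<open>even_degree_interval_certificate\<close>). It works for every large \<open>r\<close>, and \<open>\<psi>\<close> has degree exactly
  \<open>2 * r\<close>; so one \<open>r\<close> serves all components of all four constraints, as (b) demands.
\<close>

section \<open>Polynomial functions of one real variable\<close>

lemma poly_vec_nth [simp]: "poly_vec v x $ i = poly (v $ i) x"
  by (simp add: poly_vec_def)

lemma real_polynomial_function_imp_poly:
  fixes f :: "real \<Rightarrow> real"
  assumes "real_polynomial_function f"
  obtains p where "f = poly p"
proof -
  obtain a n where f: "f = (\<lambda>x. \<Sum>i\<le>n. a i * x ^ i)"
    using assms real_polynomial_function_iff_sum by blast
  have "f = poly (\<Sum>i\<le>n. monom (a i) i)"
    by (auto simp: f poly_sum poly_monom)
  then show ?thesis using that by blast
qed

lemma real_polynomial_function_poly: "real_polynomial_function (poly (p :: real poly))"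
  unfolding real_polynomial_function_iff_sum by (metis poly_altdef)

lemma real_polynomial_function_nth:
  assumes "polynomial_function f"
  shows "real_polynomial_function (\<lambda>x. f x $ i)"
  using assms bounded_linear_vec_nth[of i] by (auto simp: polynomial_function_def o_def)

lemma real_polynomial_function_entry:
  assumes "polynomial_function M"
  shows "real_polynomial_function (\<lambda>x. M x $ i $ j)"
proof -
  have "bounded_linear (\<lambda>N. N $ i $ j)"
    by (rule bounded_linear_compose[OF bounded_linear_vec_nth bounded_linear_vec_nth])
  then show ?thesis using assms by (auto simp: polynomial_function_def o_def)
qed

lemma real_polynomial_function_matrix_vector_mult:
  assumes "\<And>j. real_polynomial_function (\<lambda>x. M x $ i $ j)"
    and "\<And>j. real_polynomial_function (\<lambda>x. v x $ j)"
  shows "real_polynomial_function (\<lambda>x. (M x *v v x) $ i)"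
  unfolding matrix_vector_mult_def
  by (simp, intro real_polynomial_function_sum real_polynomial_function.intros(4) assms) simp

section \<open>Sums of squares and nonnegative polynomials\<close>

lemma sos_nonneg: "sos p \<Longrightarrow> 0 \<le> p x"
  by (auto simp: sos_def intro!: sum_list_nonneg)

lemma csos_nonneg: "csos v \<Longrightarrow> 0 \<le> v x $ i"
  using sos_nonneg[of "\<lambda>x. v x $ i"] by (simp add: csos_def)

lemma sos_const: "0 \<le> c \<Longrightarrow> sos (\<lambda>_. c)"
  unfolding sos_def by (rule exI[of _ "[[:sqrt c:]]"]) simp

lemma sos_add:
  assumes "sos f" "sos g"
  shows "sos (\<lambda>x. f x + g x)"
proof -
  obtain qs rs where "\<forall>x. f x = (\<Sum>q\<leftarrow>qs. (poly q x)\<^sup>2)" "\<forall>x. g x = (\<Sum>q\<leftarrow>rs. (poly q x)\<^sup>2)"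
    using assms by (auto simp: sos_def)
  then show ?thesis
    unfolding sos_def by (intro exI[of _ "qs @ rs"]) simp
qed

lemma sos_square_mult:
  assumes "sos f"
  shows "sos (\<lambda>x. (poly p x)\<^sup>2 * f x)"
proof -
  obtain qs where "\<forall>x. f x = (\<Sum>q\<leftarrow>qs. (poly q x)\<^sup>2)"
    using assms by (auto simp: sos_def)
  then show ?thesis
    unfolding sos_def
    by (intro exI[of _ "map ((*) p) qs"]) (simp add: o_def power_mult_distrib sum_list_const_mult)
qed

lemma abs_poly_le_power:
  fixes p :: "real poly"
  assumes "1 \<le> \<bar>x\<bar>"
  shows "\<bar>poly p x\<bar> \<le> (\<Sum>i\<le>degree p. \<bar>coeff p i\<bar>) * \<bar>x\<bar> ^ degree p"
proof -
  have "\<bar>poly p x\<bar> \<le> (\<Sum>i\<le>degree p. \<bar>coeff p i\<bar> * \<bar>x\<bar> ^ i)"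
    unfolding poly_altdef by (rule order_trans[OF sum_abs]) (simp add: abs_mult power_abs)
  also have "\<dots> \<le> (\<Sum>i\<le>degree p. \<bar>coeff p i\<bar> * \<bar>x\<bar> ^ degree p)"
    using assms by (intro sum_mono mult_left_mono power_increasing) auto
  finally show ?thesis by (simp add: sum_distrib_right)
qed

text \<open>A nonconstant polynomial is unbounded in absolute value at infinity; if it is also
  nonnegative, the infimum over the line is that over some compact ball.\<close>

lemma nonneg_poly_attains_min:
  fixes p :: "real poly"
  assumes "\<And>x. 0 \<le> poly p x"
  shows "\<exists>a. \<forall>x. poly p a \<le> poly p x"
proof (cases "degree p = 0")
  case True
  then obtain c where "p = [:c:]" by (rule degree_eq_zeroE)
  then show ?thesis by simp
next
  case False
  then have "filterlim (poly p) at_infinity at_infinity"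
    by (intro filterlim_poly_at_infinity) auto
  then have "\<forall>\<^sub>F x in at_infinity. norm (poly p x) \<ge> poly p 0"
    using assms by (cases "poly p 0 = 0") (auto simp: filterlim_at_infinity[of 0] less_le)
  then obtain B where B: "\<And>x. B \<le> \<bar>x\<bar> \<Longrightarrow> poly p 0 \<le> poly p x"
    using assms by (auto simp: eventually_at_infinity)
  have "\<exists>a\<in>cball 0 \<bar>B\<bar>. \<forall>x\<in>cball 0 \<bar>B\<bar>. poly p a \<le> poly p x"
    by (intro continuous_attains_inf continuous_at_imp_continuous_on) auto
  then obtain a where "\<forall>x\<in>cball 0 \<bar>B\<bar>. poly p a \<le> poly p x"
    by blast
  then have a: "\<And>x. \<bar>x\<bar> \<le> \<bar>B\<bar> \<Longrightarrow> poly p a \<le> poly p x"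
    by simp
  have "poly p a \<le> poly p x" for x
    using a[of x] a[of 0] B[of x] by force
  then show ?thesis by blast
qed

text \<open>A zero of a nonnegative polynomial is a minimum, hence a zero of the derivative too, and
  therefore has multiplicity at least two. The cofactor inherits nonnegativity away from the zero,
  and at the zero by continuity.\<close>

lemma nonneg_poly_double_root:
  fixes p :: "real poly"
  assumes nonneg: "\<And>x. 0 \<le> poly p x" and root: "poly p a = 0"
  obtains q where "p = [:-a, 1:]\<^sup>2 * q" "\<And>x. 0 \<le> poly q x"
proof -
  obtain q1 where q1: "p = [:-a, 1:] * q1"
    using root by (auto simp: poly_eq_0_iff_dvd)
  \<comment> \<open>p has a minimum at a, so its derivative, which is q1 at that point, vanishes there.\<close>
  have "poly (pderiv p) a = 0"
    using DERIV_local_min[OF poly_DERIV[of p a], of 1] nonneg root by auto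
  then have "poly q1 a = 0"
    by (simp add: q1 pderiv_mult pderiv_pCons del: mult_pCons_left)
  then obtain q where q: "q1 = [:-a, 1:] * q"
    by (auto simp: poly_eq_0_iff_dvd)
  have p: "p = [:-a, 1:]\<^sup>2 * q"
    by (simp only: q1 q power2_eq_square mult.assoc)
  have off: "0 \<le> poly q x" if "x \<noteq> a" for x
  proof -
    have "0 \<le> (x - a)\<^sup>2 * poly q x"
      using nonneg[of x] by (simp add: p power2_eq_square algebra_simps)
    then show ?thesis using that by (simp add: zero_le_mult_iff)
  qed
  have "(poly q \<longlongrightarrow> poly q a) (at a)"
    using isCont_def poly_isCont by blast
  then have "0 \<le> poly q a"
    by (rule tendsto_lowerbound) (auto simp: eventually_at off intro!: exI[of _ 1])
  with off have "0 \<le> poly q x" for x by (cases "x = a") auto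
  with p that show ?thesis by blast
qed

text \<open>Subtracting the minimum \<open>m\<close> from \<open>p\<close> creates a double root \<open>a\<close>, so \<open>p = (x - a)\<^sup>2 * q + m\<close> with
  \<open>q\<close> nonnegative and of smaller degree. By induction \<open>q\<close> is a sum of squares, and multiplying by a
  square and adding the nonnegative constant \<open>m\<close> keeps it one.\<close>

lemma nonneg_poly_sos:
  fixes p :: "real poly"
  assumes "\<And>x. 0 \<le> poly p x"
  shows "sos (poly p)"
  using assms
proof (induction "degree p" arbitrary: p rule: less_induct)
  case less
  obtain a where a: "\<And>x. poly p a \<le> poly p x"
    using nonneg_poly_attains_min less.prems by blast
  define m where "m = poly p a"
  have "\<And>x. 0 \<le> poly (p - [:m:]) x" "poly (p - [:m:]) a = 0"
    using a by (auto simp: m_def)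
  then obtain q where q: "p - [:m:] = [:-a, 1:]\<^sup>2 * q" and q0: "\<And>x. 0 \<le> poly q x"
    using nonneg_poly_double_root by blast
  have p: "p = [:-a, 1:]\<^sup>2 * q + [:m:]"
    using q by (metis diff_eq_eq)
  have "sos (poly q)"
  proof (cases "q = 0")
    case True
    then show ?thesis using sos_const[of 0] by (simp add: fun_eq_iff sos_def)
  next
    case False
    have d: "degree ([:-a, 1:]\<^sup>2 * q) = 2 + degree q"
      using False by (simp add: degree_mult_eq degree_power_eq)
    then have "degree p = 2 + degree q"
      unfolding p by (subst degree_add_eq_left) auto
    then show ?thesis using less.hyps q0 by simp
  qed
  then have "sos (\<lambda>x. (poly [:-a, 1:] x)\<^sup>2 * poly q x + m)"
    using less.prems[of a] by (intro sos_add sos_square_mult sos_const) (auto simp: m_def)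
  also have "(\<lambda>x. (poly [:-a, 1:] x)\<^sup>2 * poly q x + m) = poly p"
    by (rule ext, subst p, simp only: poly_add poly_mult poly_power) simp
  finally show ?case .
qed

section \<open>Positivity certificates on an interval\<close>

text \<open>Let \<open>m\<close> be the midpoint and \<open>h\<close> the half-width of \<open>[a, b]\<close>, so that
  \<open>(x - a) * (b - x) = h\<^sup>2 - (x - m)\<^sup>2\<close>. By continuity \<open>p\<close> is still positive for \<open>\<bar>x - m\<bar> \<le> s'\<close> with
  some \<open>s' > h\<close>. Pick \<open>s\<close> strictly between \<open>h\<close> and \<open>s'\<close>, and let \<open>\<psi> x = c * ((x - m) / s) ^ (2 * r)\<close>.

  On \<open>[a, b]\<close> the power is at most 1, so the product subtracted from \<open>p\<close> is at most \<open>c * h\<^sup>2\<close>, which a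
  small \<open>c\<close> keeps below the minimum of \<open>p\<close>. Outside \<open>[a, b]\<close> the product is nonpositive, so nothing
  is lost where \<open>p\<close> is positive. Beyond distance \<open>s'\<close>, the base \<open>\<bar>x - m\<bar> / s\<close> is at least
  \<open>s' / s > 1\<close>, and for large \<open>r\<close> the power outgrows \<open>p\<close>.

  Since only \<open>s > 0\<close> is divided by, a degenerate interval \<open>a = b\<close>, where \<open>h = 0\<close>, is covered.\<close>

lemma even_degree_interval_certificate:
  fixes p :: "real poly"
  assumes "a \<le> b" and pos: "\<And>x. x \<in> {a..b} \<Longrightarrow> 0 < poly p x"
  shows "\<exists>r0. \<forall>r\<ge>r0. \<exists>\<psi>. degree \<psi> = 2 * r \<and> sos (poly \<psi>) \<and>
           (\<forall>x. 0 \<le> poly p x - (x - a) * (b - x) * poly \<psi> x)"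
proof -
  obtain \<delta> where "\<delta> > 0" and \<delta>: "\<And>x. x \<in> {a..b} \<Longrightarrow> \<delta> \<le> poly p x"
  proof -
    have "\<exists>y\<in>{a..b}. \<forall>x\<in>{a..b}. poly p y \<le> poly p x"
      using \<open>a \<le> b\<close> by (intro continuous_attains_inf continuous_at_imp_continuous_on) auto
    then show ?thesis using that pos by blast
  qed
  have "open {x. 0 < poly p x}"
    by (intro open_Collect_less continuous_intros)
  moreover have "{a..b} \<subseteq> {x. 0 < poly p x}" using pos by auto
  ultimately obtain e where "e > 0" and e: "(\<Union>x\<in>{a..b}. ball x e) \<subseteq> {x. 0 < poly p x}"
    using compact_subset_open_imp_ball_epsilon_subset compact_Icc by metis
  define m h where "m = (a + b) / 2" and "h = (b - a) / 2"
  define s s' where "s = h + e / 4" and "s' = h + e / 2"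
  define c where "c = \<delta> / (h\<^sup>2 + 1)"
  have "0 \<le> h"
    using \<open>a \<le> b\<close> by (simp add: h_def)
  then have h: "0 \<le> h" "h < s" "0 < s" "s < s'" "0 < s'"
    using \<open>e > 0\<close> by (auto simp: s_def s'_def)
  have "0 < h\<^sup>2 + 1" by (simp add: add_nonneg_pos)
  then have c: "0 < c" "c * h\<^sup>2 \<le> \<delta>"
    using \<open>\<delta> > 0\<close> by (auto simp: c_def field_simps)
  have g: "(x - a) * (b - x) = h\<^sup>2 - (x - m)\<^sup>2" for x
    by (simp add: m_def h_def power2_eq_square field_simps)
  \<comment> \<open>Such an x lies within e of its projection onto the interval.\<close>
  have near: "0 < poly p x" if "\<bar>x - m\<bar> \<le> s'" for x
  proof -
    define y where "y = max a (min b x)"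
    have "y \<in> {a..b}" "x \<in> ball y e"
      using that \<open>a \<le> b\<close> \<open>e > 0\<close>
      by (auto simp: y_def dist_real_def s'_def m_def h_def max_def min_def abs_if field_simps
            split: if_splits)
    then show ?thesis using e by blast
  qed
  \<comment> \<open>q is p in the coordinate (x - m) / s, whose powers make up the multiplier.\<close>
  define q where "q = pcompose p [:m, s:]"
  define L where "L = (\<Sum>i\<le>degree q. \<bar>coeff q i\<bar>)"
  have far: "\<bar>poly p x\<bar> \<le> L * \<bar>(x - m) / s\<bar> ^ degree q" if "s \<le> \<bar>x - m\<bar>" for x
    using abs_poly_le_power[of "(x - m) / s" q] that h
    by (simp add: L_def q_def poly_pcompose)
  have pos': "0 < c * (s'\<^sup>2 - h\<^sup>2)"
    using c h by (simp add: power_strict_mono)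
  obtain N where N: "L / (c * (s'\<^sup>2 - h\<^sup>2)) < (s' / s) ^ N"
    using real_arch_pow[of "s' / s"] h by auto
  show ?thesis
  proof (intro exI[of _ "degree q + N"] allI impI)
    fix r assume r: "degree q + N \<le> r"
    define \<psi> where "\<psi> = smult c ([:- m / s, 1 / s:] ^ (2 * r))"
    have \<psi>: "poly \<psi> x = c * ((x - m) / s) ^ (2 * r)" for x
      by (simp add: \<psi>_def poly_power diff_divide_distrib)
    have "degree \<psi> = 2 * r"
      using c h by (simp add: \<psi>_def degree_power_eq)
    moreover have "0 \<le> poly \<psi> x" for x
      using c by (simp add: \<psi> zero_le_even_power)
    moreover have "0 \<le> poly p x - (x - a) * (b - x) * poly \<psi> x" for x
    proof -
      consider "\<bar>x - m\<bar> \<le> h" | "h < \<bar>x - m\<bar>" "\<bar>x - m\<bar> \<le> s'" | "s' < \<bar>x - m\<bar>"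
        by linarith
      then show ?thesis
      proof cases
        case 1
        then have "x \<in> {a..b}" by (auto simp: m_def h_def abs_le_iff field_simps)
        then have "\<delta> \<le> poly p x" by (rule \<delta>)
        moreover have "(x - a) * (b - x) * poly \<psi> x \<le> h\<^sup>2 * c"
        proof (rule mult_mono)
          have "\<bar>(x - m) / s\<bar> ^ (2 * r) \<le> 1"
            using 1 h by (intro power_le_one) auto
          then have "((x - m) / s) ^ (2 * r) \<le> 1" by (simp add: power_even_abs del: abs_divide)
          then show "poly \<psi> x \<le> c"
            using c by (simp add: \<psi>)
        qed (use c \<open>0 \<le> poly \<psi> x\<close> in \<open>auto simp: g\<close>)
        ultimately show ?thesis using c by (simp add: mult.commute)
      next
        case 2
        have "h\<^sup>2 \<le> \<bar>x - m\<bar>\<^sup>2" using 2 h by (intro power_mono) auto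
        then have "(x - a) * (b - x) \<le> 0" by (simp add: g)
        then have "(x - a) * (b - x) * poly \<psi> x \<le> 0"
          using \<open>0 \<le> poly \<psi> x\<close> by (rule mult_nonpos_nonneg)
        then show ?thesis using near[OF 2(2)] by linarith
      next
        case 3
        define u where "u = \<bar>(x - m) / s\<bar>"
        have u: "s' / s \<le> u" using 3 h by (simp add: u_def divide_right_mono)
        have u1: "1 \<le> u" using u h by (meson less_divide_eq_1_pos less_imp_le order_trans)
        have "L \<le> c * (s'\<^sup>2 - h\<^sup>2) * (s' / s) ^ N"
          using N pos' by (simp add: pos_divide_less_eq mult.commute)
        also have "\<dots> \<le> c * (s'\<^sup>2 - h\<^sup>2) * u ^ N"
          using u h pos' by (intro mult_left_mono power_mono) auto
        finally have "L * u ^ degree q \<le> c * (s'\<^sup>2 - h\<^sup>2) * u ^ N * u ^ degree q"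
          using u1 by (intro mult_right_mono) auto
        also have "\<dots> = c * (s'\<^sup>2 - h\<^sup>2) * u ^ (N + degree q)"
          by (simp add: power_add)
        also have "\<dots> \<le> c * (s'\<^sup>2 - h\<^sup>2) * u ^ (2 * r)"
          using r u1 pos' by (intro mult_left_mono power_increasing) auto
        also have "\<dots> = (s'\<^sup>2 - h\<^sup>2) * poly \<psi> x"
          by (simp add: \<psi> u_def power_even_abs del: abs_divide)
        also have "\<dots> \<le> ((x - m)\<^sup>2 - h\<^sup>2) * poly \<psi> x"
        proof (rule mult_right_mono)
          have "s'\<^sup>2 \<le> \<bar>x - m\<bar>\<^sup>2" using 3 h by (intro power_mono) auto
          then show "s'\<^sup>2 - h\<^sup>2 \<le> (x - m)\<^sup>2 - h\<^sup>2" by simp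
        qed (use \<open>0 \<le> poly \<psi> x\<close> in simp)
        finally have "L * u ^ degree q \<le> - ((x - a) * (b - x) * poly \<psi> x)"
          unfolding g by (simp only: left_diff_distrib minus_diff_eq)
        moreover have "\<bar>poly p x\<bar> \<le> L * u ^ degree q"
          using far[of x] 3 h by (simp add: u_def)
        ultimately show ?thesis by linarith
      qed
    qed
    ultimately show "\<exists>\<psi>. degree \<psi> = 2 * r \<and> sos (poly \<psi>) \<and>
           (\<forall>x. 0 \<le> poly p x - (x - a) * (b - x) * poly \<psi> x)"
      using nonneg_poly_sos by blast
  qed
qed


text \<open>The thresholds of the finitely many components have a maximum, so all components of the
  multiplier can be given the same degree.\<close>

lemma csos_interval_certificate:
  fixes v :: "real \<Rightarrow> real ^ 'n"
  assumes "a \<le> b" and poly: "\<And>i. real_polynomial_function (\<lambda>x. v x $ i)"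
    and pos: "\<And>x i. x \<in> {a..b} \<Longrightarrow> \<epsilon> < v x $ i"
  shows "\<exists>r0. \<forall>r\<ge>r0. \<exists>\<psi> :: real poly ^ 'n. degree_vec \<psi> = 2 * r \<and> csos (poly_vec \<psi>) \<and>
           csos (\<lambda>x. v x - ((x - a) * (b - x)) *\<^sub>R poly_vec \<psi> x - \<epsilon> *\<^sub>R 1)"
proof -
  have "\<exists>p. \<forall>x. v x $ i = poly p x" for i
    using real_polynomial_function_imp_poly[OF poly] by metis
  then obtain p where p: "\<And>i x. v x $ i = poly (p i) x" by metis
  define cert where "cert r i \<psi> \<longleftrightarrow> degree \<psi> = 2 * r \<and> sos (poly \<psi>) \<and>
      (\<forall>x. 0 \<le> poly (p i - [:\<epsilon>:]) x - (x - a) * (b - x) * poly \<psi> x)" for r i \<psi>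
  have "\<exists>r0. \<forall>r\<ge>r0. \<exists>\<psi>. cert r i \<psi>" for i
    unfolding cert_def using pos
    by (intro even_degree_interval_certificate \<open>a \<le> b\<close>) (simp add: p)
  then obtain R where R: "\<And>i r. R i \<le> r \<Longrightarrow> \<exists>\<psi>. cert r i \<psi>"
    by metis
  show ?thesis
  proof (intro exI[of _ "Max (range R)"] allI impI)
    fix r assume "Max (range R) \<le> r"
    then have "\<forall>i. \<exists>\<psi>. cert r i \<psi>"
      using R by simp
    then obtain \<psi> where "\<And>i. cert r i (\<psi> i)"
      by metis
    then have \<psi>: "\<And>i. degree (\<psi> i) = 2 * r" "\<And>i. sos (poly (\<psi> i))"
        "\<And>i x. 0 \<le> poly (p i - [:\<epsilon>:]) x - (x - a) * (b - x) * poly (\<psi> i) x"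
      by (simp_all add: cert_def)
    have "sos (\<lambda>x. v x $ i - (x - a) * (b - x) * poly (\<psi> i) x - \<epsilon>)" for i
    proof -
      let ?w = "p i - [:\<epsilon>:] - [:- a, 1:] * [:b, -1:] * \<psi> i"
      have eq: "poly ?w x = v x $ i - (x - a) * (b - x) * poly (\<psi> i) x - \<epsilon>" for x
        by (simp add: p algebra_simps)
      have "sos (poly ?w)"
        using \<psi>(3)[of i] by (intro nonneg_poly_sos) (simp only: eq, simp add: p algebra_simps)
      then show ?thesis by (simp only: eq sos_def)
    qed
    moreover have "degree_vec (\<chi> i. \<psi> i) = 2 * r"
      by (simp add: degree_vec_def \<psi>(1))
    ultimately show "\<exists>\<psi> :: real poly ^ 'n. degree_vec \<psi> = 2 * r \<and> csos (poly_vec \<psi>) \<and>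
           csos (\<lambda>x. v x - ((x - a) * (b - x)) *\<^sub>R poly_vec \<psi> x - \<epsilon> *\<^sub>R 1)"
      using \<psi>(2) by (intro exI[of _ "\<chi> i. \<psi> i"]) (simp add: csos_def)
  qed
qed

lemma csos_certificate_pos:
  assumes "csos (\<lambda>x. v x - g x *\<^sub>R poly_vec \<psi> x - \<epsilon> *\<^sub>R 1)" "csos (poly_vec \<psi>)"
    and "0 \<le> g x" "0 < \<epsilon>"
  shows "0 < v x $ i"
proof -
  have "0 \<le> v x $ i - g x * poly_vec \<psi> x $ i - \<epsilon>"
    using csos_nonneg[OF assms(1), of x i] by simp
  moreover have "0 \<le> g x * poly_vec \<psi> x $ i"
    using csos_nonneg[OF assms(2)] assms(3) by (rule mult_nonneg_nonneg[rotated])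
  ultimately show ?thesis using \<open>0 < \<epsilon>\<close> by linarith
qed

section \<open>Perturbation of strict inequalities\<close>

lemma uniform_slack:
  fixes v :: "'a::topological_space \<Rightarrow> real ^ 'n"
  assumes "compact S" "continuous_on S v" and pos: "\<And>x i. x \<in> S \<Longrightarrow> 0 < v x $ i"
  shows "\<exists>\<epsilon>>0. \<forall>x\<in>S. \<forall>i. \<epsilon> \<le> v x $ i"
proof (cases "S = {}")
  case True
  then show ?thesis by (auto intro: exI[of _ 1])
next
  case False
  have "\<exists>y\<in>S. \<forall>x\<in>S. v y $ i \<le> v x $ i" for i
    using assms(2) by (intro continuous_attains_inf \<open>compact S\<close> False continuous_intros)
  then obtain y where y: "\<And>i. y i \<in> S" "\<And>i x. x \<in> S \<Longrightarrow> v (y i) $ i \<le> v x $ i"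
    by metis
  let ?\<epsilon> = "Min (range (\<lambda>i. v (y i) $ i))"
  have "?\<epsilon> \<le> v x $ i" if "x \<in> S" for x i
    by (rule order_trans[OF Min_le y(2)[OF that]]) auto
  moreover have "0 < ?\<epsilon>" using pos y by (subst Min_gr_iff) auto
  ultimately show ?thesis by blast
qed

lemma matrix_vector_mult_nth_perturb:
  fixes M :: "real ^ 'n ^ 'm"
  assumes "norm M \<le> K" "norm (y - z) \<le> e"
  shows "\<bar>(M *v y) $ i - (M *v z) $ i\<bar> \<le> K * e"
proof -
  have "\<bar>(M *v y) $ i - (M *v z) $ i\<bar> = \<bar>M $ i \<bullet> (y - z)\<bar>"
    by (simp add: matrix_vector_mul_component inner_diff_right)
  also have "\<dots> \<le> norm (M $ i) * norm (y - z)"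
    by (rule Cauchy_Schwarz_ineq2)
  also have "\<dots> \<le> K * e"
    using Finite_Cartesian_Product.norm_nth_le[of M i] assms
    by (intro mult_mono) (auto intro: order_trans[OF norm_ge_zero])
  finally show ?thesis .
qed

lemma continuous_on_matrix_vector_mult:
  fixes M :: "'a::topological_space \<Rightarrow> real ^ 'n ^ 'm"
  assumes "continuous_on S M" "continuous_on S v"
  shows "continuous_on S (\<lambda>x. M x *v v x)"
  unfolding matrix_vector_mult_def by (intro continuous_intros assms)

section \<open>Polynomial approximation of continuously differentiable functions\<close>

lemma has_vector_derivative_poly_vec:
  "(poly_vec v has_vector_derivative poly_vec (\<chi> i. pderiv (v $ i)) x) (at x within S)"
  unfolding has_vector_derivative_def
proof (subst has_derivative_componentwise_within, intro ballI)
  fix e :: "real ^ 'a" assume "e \<in> Basis"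
  then obtain i where "e = axis i 1" by (auto simp: Basis_vec_def)
  then show "((\<lambda>x. poly_vec v x \<bullet> e) has_derivative
               (\<lambda>h. h *\<^sub>R poly_vec (\<chi> i. pderiv (v $ i)) x \<bullet> e)) (at x within S)"
    using DERIV_subset[OF poly_DERIV[of "v $ i" x], of S]
    by (simp add: inner_axis has_field_derivative_def mult_commute_abs)
qed

lemma vector_derivative_poly_vec:
  "vector_derivative (poly_vec v) (at x) = poly_vec (\<chi> i. pderiv (v $ i)) x"
  by (rule vector_derivative_at[OF has_vector_derivative_poly_vec])

lemma pderiv_surj: "\<exists>P. pderiv P = (p :: real poly)"
proof
  show "pderiv (\<Sum>i\<le>degree p. monom (coeff p i / real (Suc i)) (Suc i)) = p"
    by (simp add: pderiv_monom higher_pderiv_sum[of 1, simplified] poly_as_sum_of_monoms del: of_nat_Suc)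
qed

text \<open>Approximating \<open>\<zeta>\<close> directly would give no control of the derivative. Approximating the derivative
  does control \<open>\<zeta>\<close>: the error of the antiderivative vanishes at 0 and grows at most at the rate of
  the error of the derivative.\<close>

lemma poly_vec_C1_approximation:
  fixes \<zeta> :: "real \<Rightarrow> real ^ 'n"
  assumes C1: "\<zeta> C1_differentiable_on {0..T}" and "0 \<le> T" "0 < e"
  obtains Z where "poly_vec Z 0 = \<zeta> 0"
    and "\<And>\<tau>. \<tau> \<in> {0..T} \<Longrightarrow> norm (poly_vec Z \<tau> - \<zeta> \<tau>) \<le> e"
    and "\<And>\<tau>. \<tau> \<in> {0..T} \<Longrightarrow>
           norm (vector_derivative (poly_vec Z) (at \<tau>) - vector_derivative \<zeta> (at \<tau>)) \<le> e"
proof -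
  \<comment> \<open>Integration over an interval of length T multiplies the error by at most T.\<close>
  define e' where "e' = e / (1 + T)"
  have e': "0 < e'" "e' \<le> e" "e' * T \<le> e"
    using assms by (auto simp: e'_def field_simps)
  let ?D = "\<lambda>\<tau>. vector_derivative \<zeta> (at \<tau>)"
  have D: "continuous_on {0..T} ?D"
      "\<And>\<tau>. \<tau> \<in> {0..T} \<Longrightarrow> (\<zeta> has_vector_derivative ?D \<tau>) (at \<tau> within {0..T})"
    using C1 by (auto simp: C1_differentiable_on_eq vector_derivative_works[symmetric]
        intro: has_vector_derivative_at_within)
  obtain G where G: "polynomial_function G" "\<And>\<tau>. \<tau> \<in> {0..T} \<Longrightarrow> norm (?D \<tau> - G \<tau>) < e'"
    using Stone_Weierstrass_polynomial_function[OF compact_Icc D(1) e'(1)] by blast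
  have "\<exists>P. \<forall>\<tau>. G \<tau> $ i = poly (pderiv P) \<tau>" for i
    using real_polynomial_function_imp_poly[OF real_polynomial_function_nth[OF G(1), of i]]
      pderiv_surj by metis
  then obtain P where P: "\<And>i \<tau>. G \<tau> $ i = poly (pderiv (P i)) \<tau>" by metis
  define Z where "Z = (\<chi> i. P i + [:\<zeta> 0 $ i - poly (P i) 0:])"
  have Z0: "poly_vec Z 0 = \<zeta> 0"
    by (simp add: vec_eq_iff Z_def)
  have Z': "poly_vec (\<chi> i. pderiv (Z $ i)) \<tau> = G \<tau>" for \<tau>
    by (simp add: vec_eq_iff Z_def P pderiv_add pderiv_pCons)
  have diff: "norm (G \<tau> - ?D \<tau>) \<le> e'" if "\<tau> \<in> {0..T}" for \<tau>
    using G(2)[OF that] by (simp add: norm_minus_commute)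
  have "norm (poly_vec Z \<tau> - \<zeta> \<tau>) \<le> e" if \<tau>: "\<tau> \<in> {0..T}" for \<tau>
  proof -
    have "norm ((poly_vec Z \<tau> - \<zeta> \<tau>) - (poly_vec Z 0 - \<zeta> 0)) \<le> e' * norm (\<tau> - 0)"
    proof (rule differentiable_bound[where S = "{0..T}" and f' = "\<lambda>x h. h *\<^sub>R (G x - ?D x)"])
      fix x assume x: "x \<in> {0..T}"
      have "((\<lambda>x. poly_vec Z x - \<zeta> x) has_vector_derivative G x - ?D x) (at x within {0..T})"
        using has_vector_derivative_diff[OF has_vector_derivative_poly_vec[of Z x] D(2)[OF x]]
        by (simp only: Z')
      then show "((\<lambda>x. poly_vec Z x - \<zeta> x) has_derivative (\<lambda>h. h *\<^sub>R (G x - ?D x)))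
                   (at x within {0..T})"
        by (simp add: has_vector_derivative_def)
      show "onorm (\<lambda>h. h *\<^sub>R (G x - ?D x)) \<le> e'"
        using diff[OF x] by (intro onorm_le) (auto simp: mult.commute[of e'] intro: mult_left_mono)
    qed (use \<tau> in auto)
    also have "\<dots> \<le> e' * T" using \<tau> e' by simp
    finally show ?thesis using e' by (simp add: Z0)
  qed
  moreover have "norm (vector_derivative (poly_vec Z) (at \<tau>) - ?D \<tau>) \<le> e"
    if "\<tau> \<in> {0..T}" for \<tau>
    using diff[OF that] e' by (simp only: vector_derivative_poly_vec Z')
  ultimately show ?thesis using that Z0 by blast
qed

section \<open>Equivalence of the differential inequalities and the sum-of-squares program\<close>

theorem theorem3p7:
  fixes Tmin Tmax :: real
    and A :: "real \<Rightarrow> real ^ 'n ^ 'n"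
    and Ec :: "real \<Rightarrow> real ^ 'pc ^ 'n"
    and Cc :: "real \<Rightarrow> real ^ 'n ^ 'qc"
    and Fc :: "real \<Rightarrow> real ^ 'pc ^ 'qc"
    and J :: "real ^ 'n ^ 'n"
    and Ed :: "real ^ 'pd ^ 'n"
    and Cd :: "real ^ 'n ^ 'qd"
    and Fd :: "real ^ 'pd ^ 'qd"
  assumes "0 < Tmin" and "Tmin \<le> Tmax"
    and "polynomial_function A" and "polynomial_function Ec"
    and "polynomial_function Cc" and "polynomial_function Fc"
    and "\<And>\<tau>. \<tau> \<in> {0..Tmax} \<Longrightarrow> metzler (A \<tau>)"
    and "\<And>\<tau>. \<tau> \<in> {0..Tmax} \<Longrightarrow> 0 \<le> Ec \<tau>"
    and "\<And>\<tau>. \<tau> \<in> {0..Tmax} \<Longrightarrow> 0 \<le> Cc \<tau>"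
    and "\<And>\<tau>. \<tau> \<in> {0..Tmax} \<Longrightarrow> 0 \<le> Fc \<tau>"
    and "0 \<le> J" and "0 \<le> Ed" and "0 \<le> Cd" and "0 \<le> Fd"
  shows
    "(\<exists>(\<zeta> :: real \<Rightarrow> real ^ 'n) (\<gamma> :: real).
        \<zeta> C1_differentiable_on UNIV \<and> 0 <\<^sub>v \<zeta> 0 \<and>
        (\<forall>\<tau>\<in>{0..Tmax}. \<forall>\<theta>\<in>{Tmin..Tmax}.
          - vector_derivative \<zeta> (at \<tau>) + A \<tau> *v \<zeta> \<tau> + Ec \<tau> *v 1 <\<^sub>v 0 \<and>
          Cc \<tau> *v \<zeta> \<tau> + Fc \<tau> *v 1 - \<gamma> *\<^sub>R 1 <\<^sub>v 0 \<and>
          J *v \<zeta> \<theta> - \<zeta> 0 + Ed *v 1 <\<^sub>v 0 \<and>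
          Cd *v \<zeta> \<theta> + Fd *v 1 - \<gamma> *\<^sub>R 1 <\<^sub>v 0))
     \<longleftrightarrow>
     (\<exists>(d :: nat) (r :: nat) (\<zeta> :: real poly ^ 'n)
        (\<psi>1 :: real poly ^ 'n) (\<psi>2 :: real poly ^ 'n)
        (\<psi>3 :: real poly ^ 'qc) (\<psi>4 :: real poly ^ 'qd) (\<gamma> :: real) (\<epsilon> :: real).
        degree_vec \<zeta> = d \<and>
        degree_vec \<psi>1 = 2 * r \<and> degree_vec \<psi>2 = 2 * r \<and>
        degree_vec \<psi>3 = 2 * r \<and> degree_vec \<psi>4 = 2 * r \<and>
        0 \<le> \<gamma> \<and> 0 < \<epsilon> \<and>
        csos (poly_vec \<psi>1) \<and> csos (poly_vec \<psi>2) \<and>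
        csos (poly_vec \<psi>3) \<and> csos (poly_vec \<psi>4) \<and>
        (0 \<le> poly_vec \<zeta> 0 - \<epsilon> *\<^sub>R 1 \<or> csos (\<lambda>_. poly_vec \<zeta> 0 - \<epsilon> *\<^sub>R 1)) \<and>
        csos (\<lambda>\<tau>. vector_derivative (poly_vec \<zeta>) (at \<tau>) - A \<tau> *v poly_vec \<zeta> \<tau> - Ec \<tau> *v 1
                    - (\<tau> * (Tmax - \<tau>)) *\<^sub>R poly_vec \<psi>1 \<tau> - \<epsilon> *\<^sub>R 1) \<and>
        csos (\<lambda>\<theta>. - (J *v poly_vec \<zeta> \<theta>) + poly_vec \<zeta> 0 - Ed *v 1
                    - ((\<theta> - Tmin) * (Tmax - \<theta>)) *\<^sub>R poly_vec \<psi>2 \<theta> - \<epsilon> *\<^sub>R 1) \<and>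
        csos (\<lambda>\<tau>. - (Cc \<tau> *v poly_vec \<zeta> \<tau>) - Fc \<tau> *v 1 + \<gamma> *\<^sub>R 1
                    - (\<tau> * (Tmax - \<tau>)) *\<^sub>R poly_vec \<psi>3 \<tau> - \<epsilon> *\<^sub>R 1) \<and>
        csos (\<lambda>\<theta>. - (Cd *v poly_vec \<zeta> \<theta>) - Fd *v 1 + \<gamma> *\<^sub>R 1
                    - ((\<theta> - Tmin) * (Tmax - \<theta>)) *\<^sub>R poly_vec \<psi>4 \<theta> - \<epsilon> *\<^sub>R 1))"
  (is "?C1 \<longleftrightarrow> ?SOS")
proof
  assume ?SOS
  then obtain \<zeta> \<psi>1 \<psi>2 \<psi>3 \<psi>4 \<gamma> \<epsilon> where "0 < \<epsilon>"
    and \<psi>: "csos (poly_vec \<psi>1)" "csos (poly_vec \<psi>2)" "csos (poly_vec \<psi>3)" "csos (poly_vec \<psi>4)"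
    and zero: "0 \<le> poly_vec \<zeta> 0 - \<epsilon> *\<^sub>R 1 \<or> csos (\<lambda>_. poly_vec \<zeta> 0 - \<epsilon> *\<^sub>R 1)"
    and cert:
      "csos (\<lambda>\<tau>. vector_derivative (poly_vec \<zeta>) (at \<tau>) - A \<tau> *v poly_vec \<zeta> \<tau> - Ec \<tau> *v 1
                    - (\<tau> * (Tmax - \<tau>)) *\<^sub>R poly_vec \<psi>1 \<tau> - \<epsilon> *\<^sub>R 1)"
      "csos (\<lambda>\<theta>. - (J *v poly_vec \<zeta> \<theta>) + poly_vec \<zeta> 0 - Ed *v 1
                    - ((\<theta> - Tmin) * (Tmax - \<theta>)) *\<^sub>R poly_vec \<psi>2 \<theta> - \<epsilon> *\<^sub>R 1)"
      "csos (\<lambda>\<tau>. - (Cc \<tau> *v poly_vec \<zeta> \<tau>) - Fc \<tau> *v 1 + \<gamma> *\<^sub>R 1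
                    - (\<tau> * (Tmax - \<tau>)) *\<^sub>R poly_vec \<psi>3 \<tau> - \<epsilon> *\<^sub>R 1)"
      "csos (\<lambda>\<theta>. - (Cd *v poly_vec \<zeta> \<theta>) - Fd *v 1 + \<gamma> *\<^sub>R 1
                    - ((\<theta> - Tmin) * (Tmax - \<theta>)) *\<^sub>R poly_vec \<psi>4 \<theta> - \<epsilon> *\<^sub>R 1)"
    by (elim exE conjE)
  have "poly_vec \<zeta> C1_differentiable_on UNIV"
    unfolding C1_differentiable_on_def
    using has_vector_derivative_poly_vec
    by (intro exI[of _ "poly_vec (\<chi> i. pderiv (\<zeta> $ i))"] conjI ballI
        continuous_on_vector_derivative) auto
  moreover have "0 <\<^sub>v poly_vec \<zeta> 0"
  proof -
    have "0 \<le> poly_vec \<zeta> 0 $ i - \<epsilon>" for i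
      using zero
    proof
      assume "csos (\<lambda>_. poly_vec \<zeta> 0 - \<epsilon> *\<^sub>R 1)"
      from csos_nonneg[OF this, of i] show ?thesis by simp
    qed (simp add: less_eq_vec_def)
    then show ?thesis
      using \<open>0 < \<epsilon>\<close> unfolding vec_less_def zero_index by (meson diff_ge_0_iff_ge less_le_trans)
  qed
  moreover have "- vector_derivative (poly_vec \<zeta>) (at \<tau>) + A \<tau> *v poly_vec \<zeta> \<tau> + Ec \<tau> *v 1 <\<^sub>v 0"
      "Cc \<tau> *v poly_vec \<zeta> \<tau> + Fc \<tau> *v 1 - \<gamma> *\<^sub>R 1 <\<^sub>v 0" if "\<tau> \<in> {0..Tmax}" for \<tau>
  proof -
    have "0 \<le> \<tau> * (Tmax - \<tau>)" using that by simp
    then show "- vector_derivative (poly_vec \<zeta>) (at \<tau>) + A \<tau> *v poly_vec \<zeta> \<tau> + Ec \<tau> *v 1 <\<^sub>v 0"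
        "Cc \<tau> *v poly_vec \<zeta> \<tau> + Fc \<tau> *v 1 - \<gamma> *\<^sub>R 1 <\<^sub>v 0"
      using csos_certificate_pos[OF cert(1) \<psi>(1) _ \<open>0 < \<epsilon>\<close>, of \<tau>]
        csos_certificate_pos[OF cert(3) \<psi>(3) _ \<open>0 < \<epsilon>\<close>, of \<tau>]
      by (simp_all add: vec_less_def algebra_simps)
  qed
  moreover have "J *v poly_vec \<zeta> \<theta> - poly_vec \<zeta> 0 + Ed *v 1 <\<^sub>v 0"
      "Cd *v poly_vec \<zeta> \<theta> + Fd *v 1 - \<gamma> *\<^sub>R 1 <\<^sub>v 0" if "\<theta> \<in> {Tmin..Tmax}" for \<theta>
  proof -
    have "0 \<le> (\<theta> - Tmin) * (Tmax - \<theta>)" using that by simp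
    then show "J *v poly_vec \<zeta> \<theta> - poly_vec \<zeta> 0 + Ed *v 1 <\<^sub>v 0"
        "Cd *v poly_vec \<zeta> \<theta> + Fd *v 1 - \<gamma> *\<^sub>R 1 <\<^sub>v 0"
      using csos_certificate_pos[OF cert(2) \<psi>(2) _ \<open>0 < \<epsilon>\<close>, of \<theta>]
        csos_certificate_pos[OF cert(4) \<psi>(4) _ \<open>0 < \<epsilon>\<close>, of \<theta>]
      by (simp_all add: vec_less_def algebra_simps)
  qed
  ultimately show ?C1 by blast
next
  assume ?C1
  then obtain \<zeta> \<gamma>0 where C1: "\<zeta> C1_differentiable_on UNIV" and zero: "0 <\<^sub>v \<zeta> 0"
    and ineqs: "\<And>\<tau> \<theta>. \<tau> \<in> {0..Tmax} \<Longrightarrow> \<theta> \<in> {Tmin..Tmax} \<Longrightarrow>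
          - vector_derivative \<zeta> (at \<tau>) + A \<tau> *v \<zeta> \<tau> + Ec \<tau> *v 1 <\<^sub>v 0 \<and>
          Cc \<tau> *v \<zeta> \<tau> + Fc \<tau> *v 1 - \<gamma>0 *\<^sub>R 1 <\<^sub>v 0 \<and>
          J *v \<zeta> \<theta> - \<zeta> 0 + Ed *v 1 <\<^sub>v 0 \<and>
          Cd *v \<zeta> \<theta> + Fd *v 1 - \<gamma>0 *\<^sub>R 1 <\<^sub>v 0"
    by blast
  define \<gamma> where "\<gamma> = max \<gamma>0 0"
  have T: "0 \<le> Tmax" "0 \<in> {0..Tmax}" "Tmax \<in> {Tmin..Tmax}" "{Tmin..Tmax} \<subseteq> {0..Tmax}"
    using assms(1,2) by auto
  let ?D = "\<lambda>\<tau>. vector_derivative \<zeta> (at \<tau>)"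
  let ?v1 = "\<lambda>z' z \<tau>. z' \<tau> - A \<tau> *v z \<tau> - Ec \<tau> *v 1"
  let ?v2 = "\<lambda>z \<theta>. - (J *v z \<theta>) + \<zeta> 0 - Ed *v 1"
  let ?v3 = "\<lambda>z \<tau>. - (Cc \<tau> *v z \<tau>) - Fc \<tau> *v 1 + \<gamma> *\<^sub>R 1"
  let ?v4 = "\<lambda>z \<theta>. - (Cd *v z \<theta>) - Fd *v 1 + \<gamma> *\<^sub>R 1"
  have pos1: "0 < ?v1 ?D \<zeta> \<tau> $ i" if "\<tau> \<in> {0..Tmax}" for \<tau> i
    using ineqs[OF that T(3)] by (auto simp: vec_less_def algebra_simps)
  have pos3: "0 < ?v3 \<zeta> \<tau> $ i" if "\<tau> \<in> {0..Tmax}" for \<tau> i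
    using ineqs[OF that T(3)] by (auto simp: vec_less_def algebra_simps \<gamma>_def max_def)
      (smt (verit))+
  have pos2: "0 < ?v2 \<zeta> \<theta> $ i" if "\<theta> \<in> {Tmin..Tmax}" for \<theta> i
    using ineqs[OF T(2) that] by (auto simp: vec_less_def algebra_simps)
  have pos4: "0 < ?v4 \<zeta> \<theta> $ i" if "\<theta> \<in> {Tmin..Tmax}" for \<theta> i
    using ineqs[OF T(2) that] by (auto simp: vec_less_def algebra_simps \<gamma>_def max_def)
      (smt (verit))+
  have cont: "continuous_on S A" "continuous_on S Ec" "continuous_on S Cc" "continuous_on S Fc" for S
    using assms(3-6) by (auto intro: continuous_on_polymonial_function)
  have contD: "continuous_on S ?D" for S
    using C1 continuous_on_subset by (auto simp: C1_differentiable_on_eq)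
  have cont\<zeta>: "continuous_on S \<zeta>" for S
    using C1 by (meson C1_differentiable_imp_continuous_on C1_differentiable_on_subset subset_UNIV)
  note cont_intros = continuous_intros continuous_on_matrix_vector_mult cont contD cont\<zeta>
  have cont_v: "continuous_on S (?v1 ?D \<zeta>)" "continuous_on S (?v2 \<zeta>)"
      "continuous_on S (?v3 \<zeta>)" "continuous_on S (?v4 \<zeta>)" for S
    by (intro cont_intros)+
  obtain \<epsilon>0 where "0 < \<epsilon>0" and \<epsilon>0: "\<And>i. \<epsilon>0 \<le> \<zeta> 0 $ i"
    using uniform_slack[of "{0}" \<zeta>] zero by (auto simp: vec_less_def)
  obtain \<epsilon>1 where "0 < \<epsilon>1" and \<epsilon>1: "\<And>\<tau> i. \<tau> \<in> {0..Tmax} \<Longrightarrow> \<epsilon>1 \<le> ?v1 ?D \<zeta> \<tau> $ i"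
    using uniform_slack[OF compact_Icc cont_v(1) pos1] by blast
  obtain \<epsilon>2 where "0 < \<epsilon>2" and \<epsilon>2: "\<And>\<tau> i. \<tau> \<in> {Tmin..Tmax} \<Longrightarrow> \<epsilon>2 \<le> ?v2 \<zeta> \<tau> $ i"
    using uniform_slack[OF compact_Icc cont_v(2) pos2] by blast
  obtain \<epsilon>3 where "0 < \<epsilon>3" and \<epsilon>3: "\<And>\<tau> i. \<tau> \<in> {0..Tmax} \<Longrightarrow> \<epsilon>3 \<le> ?v3 \<zeta> \<tau> $ i"
    using uniform_slack[OF compact_Icc cont_v(3) pos3] by blast
  obtain \<epsilon>4 where "0 < \<epsilon>4" and \<epsilon>4: "\<And>\<tau> i. \<tau> \<in> {Tmin..Tmax} \<Longrightarrow> \<epsilon>4 \<le> ?v4 \<zeta> \<tau> $ i"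
    using uniform_slack[OF compact_Icc cont_v(4) pos4] by blast
  \<comment> \<open>Of the margin, at least 4 * \<epsilon>, the approximation error uses at most \<epsilon> for the derivative and
      \<epsilon> for the matrix product; what remains exceeds \<epsilon> strictly.\<close>
  define \<epsilon> where "\<epsilon> = Min {\<epsilon>0, \<epsilon>1, \<epsilon>2, \<epsilon>3, \<epsilon>4} / 4"
  have \<epsilon>: "0 < \<epsilon>" "4 * \<epsilon> \<le> \<epsilon>0" "4 * \<epsilon> \<le> \<epsilon>1" "4 * \<epsilon> \<le> \<epsilon>2" "4 * \<epsilon> \<le> \<epsilon>3" "4 * \<epsilon> \<le> \<epsilon>4"
    using \<open>0 < \<epsilon>0\<close> \<open>0 < \<epsilon>1\<close> \<open>0 < \<epsilon>2\<close> \<open>0 < \<epsilon>3\<close> \<open>0 < \<epsilon>4\<close> by (auto simp: \<epsilon>_def)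
  obtain KA where KA: "\<And>\<tau>. \<tau> \<in> {0..Tmax} \<Longrightarrow> norm (A \<tau>) \<le> KA"
    using compact_imp_bounded[OF compact_continuous_image[OF cont(1) compact_Icc, of 0 Tmax]]
    unfolding bounded_iff by blast
  obtain KC where KC: "\<And>\<tau>. \<tau> \<in> {0..Tmax} \<Longrightarrow> norm (Cc \<tau>) \<le> KC"
    using compact_imp_bounded[OF compact_continuous_image[OF cont(3) compact_Icc, of 0 Tmax]]
    unfolding bounded_iff by blast
  define K where "K = Max {0, KA, KC, norm J, norm Cd}"
  have K: "0 \<le> K" "KA \<le> K" "KC \<le> K" "norm J \<le> K" "norm Cd \<le> K"
    by (auto simp: K_def)
  define e where "e = \<epsilon> / (1 + K)"
  have e: "0 < e" "e \<le> \<epsilon>" "K * e \<le> \<epsilon>"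
    using \<epsilon> K by (auto simp: e_def field_simps)
  obtain Z where Z0: "poly_vec Z 0 = \<zeta> 0"
    and Z: "\<And>\<tau>. \<tau> \<in> {0..Tmax} \<Longrightarrow> norm (poly_vec Z \<tau> - \<zeta> \<tau>) \<le> e"
    and Z': "\<And>\<tau>. \<tau> \<in> {0..Tmax} \<Longrightarrow>
           norm (vector_derivative (poly_vec Z) (at \<tau>) - ?D \<tau>) \<le> e"
    using poly_vec_C1_approximation[OF C1_differentiable_on_subset[OF C1 subset_UNIV] T(1) e(1)]
    by blast
  let ?Z = "poly_vec Z" and ?Z' = "\<lambda>\<tau>. vector_derivative (poly_vec Z) (at \<tau>)"
  have slack1: "\<epsilon> < ?v1 ?Z' ?Z \<tau> $ i" if "\<tau> \<in> {0..Tmax}" for \<tau> i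
  proof -
    have "\<bar>(A \<tau> *v ?Z \<tau>) $ i - (A \<tau> *v \<zeta> \<tau>) $ i\<bar> \<le> K * e"
      using KA[OF that] K(2) Z[OF that] by (intro matrix_vector_mult_nth_perturb) auto
    moreover have "\<bar>(?Z' \<tau> - ?D \<tau>) $ i\<bar> \<le> e"
      using component_le_norm_cart Z'[OF that] by (rule order_trans)
    moreover have "4 * \<epsilon> \<le> ?v1 ?D \<zeta> \<tau> $ i"
      using \<epsilon>(3) \<epsilon>1[OF that] by (rule order_trans)
    ultimately show ?thesis
      using e \<epsilon>(1) unfolding vector_minus_component by linarith
  qed
  have slack3: "\<epsilon> < ?v3 ?Z \<tau> $ i" if "\<tau> \<in> {0..Tmax}" for \<tau> i
  proof -
    have "\<bar>(Cc \<tau> *v ?Z \<tau>) $ i - (Cc \<tau> *v \<zeta> \<tau>) $ i\<bar> \<le> K * e"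
      using KC[OF that] K(3) Z[OF that] by (intro matrix_vector_mult_nth_perturb) auto
    moreover have "4 * \<epsilon> \<le> ?v3 \<zeta> \<tau> $ i"
      using \<epsilon>(5) \<epsilon>3[OF that] by (rule order_trans)
    ultimately show ?thesis
      using e \<epsilon>(1) unfolding vector_minus_component vector_add_component vector_uminus_component
      by linarith
  qed
  have slack2: "\<epsilon> < ?v2 ?Z \<theta> $ i" if "\<theta> \<in> {Tmin..Tmax}" for \<theta> i
  proof -
    have "\<bar>(J *v ?Z \<theta>) $ i - (J *v \<zeta> \<theta>) $ i\<bar> \<le> K * e"
      using K(4) Z[OF subsetD[OF T(4) that]] by (intro matrix_vector_mult_nth_perturb)
    moreover have "4 * \<epsilon> \<le> ?v2 \<zeta> \<theta> $ i"
      using \<epsilon>(4) \<epsilon>2[OF that] by (rule order_trans)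
    ultimately show ?thesis
      using e \<epsilon>(1) unfolding vector_minus_component vector_add_component vector_uminus_component
      by linarith
  qed
  have slack4: "\<epsilon> < ?v4 ?Z \<theta> $ i" if "\<theta> \<in> {Tmin..Tmax}" for \<theta> i
  proof -
    have "\<bar>(Cd *v ?Z \<theta>) $ i - (Cd *v \<zeta> \<theta>) $ i\<bar> \<le> K * e"
      using K(5) Z[OF subsetD[OF T(4) that]] by (intro matrix_vector_mult_nth_perturb)
    moreover have "4 * \<epsilon> \<le> ?v4 \<zeta> \<theta> $ i"
      using \<epsilon>(6) \<epsilon>4[OF that] by (rule order_trans)
    ultimately show ?thesis
      using e \<epsilon>(1) unfolding vector_minus_component vector_add_component vector_uminus_component
      by linarith
  qed
  note poly_intros = real_polynomial_function.intros(2) real_polynomial_function_poly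
    real_polynomial_function_diff real_polynomial_function.intros(3) real_polynomial_function_minus
    real_polynomial_function_matrix_vector_mult assms(3-6)[THEN real_polynomial_function_entry]
  have poly: "real_polynomial_function (\<lambda>\<tau>. ?v1 ?Z' ?Z \<tau> $ i)"
      "real_polynomial_function (\<lambda>\<theta>. ?v2 ?Z \<theta> $ i)" for i
    unfolding vector_derivative_poly_vec vector_minus_component vector_add_component
      vector_uminus_component poly_vec_nth by (intro poly_intros; simp add: poly_intros)+
  have poly': "real_polynomial_function (\<lambda>\<tau>. ?v3 ?Z \<tau> $ i)" for i
    unfolding vector_minus_component vector_add_component
      vector_uminus_component by (intro poly_intros; simp add: poly_intros)
  have poly'': "real_polynomial_function (\<lambda>\<theta>. ?v4 ?Z \<theta> $ i)" for i
    unfolding vector_minus_component vector_add_component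
      vector_uminus_component by (intro poly_intros; simp add: poly_intros)
  obtain r1 where r1: "\<And>r. r1 \<le> r \<Longrightarrow> \<exists>\<psi> :: real poly ^ 'n. degree_vec \<psi> = 2 * r \<and>
      csos (poly_vec \<psi>) \<and> csos (\<lambda>\<tau>. ?v1 ?Z' ?Z \<tau> - (\<tau> * (Tmax - \<tau>)) *\<^sub>R poly_vec \<psi> \<tau> - \<epsilon> *\<^sub>R 1)"
    using csos_interval_certificate[OF T(1) poly(1) slack1] unfolding diff_zero by blast
  obtain r2 where r2: "\<And>r. r2 \<le> r \<Longrightarrow> \<exists>\<psi> :: real poly ^ 'n. degree_vec \<psi> = 2 * r \<and>
      csos (poly_vec \<psi>) \<and>
      csos (\<lambda>\<theta>. ?v2 ?Z \<theta> - ((\<theta> - Tmin) * (Tmax - \<theta>)) *\<^sub>R poly_vec \<psi> \<theta> - \<epsilon> *\<^sub>R 1)"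
    using csos_interval_certificate[OF assms(2) poly(2) slack2] by blast
  obtain r3 where r3: "\<And>r. r3 \<le> r \<Longrightarrow> \<exists>\<psi> :: real poly ^ 'qc. degree_vec \<psi> = 2 * r \<and>
      csos (poly_vec \<psi>) \<and> csos (\<lambda>\<tau>. ?v3 ?Z \<tau> - (\<tau> * (Tmax - \<tau>)) *\<^sub>R poly_vec \<psi> \<tau> - \<epsilon> *\<^sub>R 1)"
    using csos_interval_certificate[OF T(1) poly' slack3] unfolding diff_zero by blast
  obtain r4 where r4: "\<And>r. r4 \<le> r \<Longrightarrow> \<exists>\<psi> :: real poly ^ 'qd. degree_vec \<psi> = 2 * r \<and>
      csos (poly_vec \<psi>) \<and>
      csos (\<lambda>\<theta>. ?v4 ?Z \<theta> - ((\<theta> - Tmin) * (Tmax - \<theta>)) *\<^sub>R poly_vec \<psi> \<theta> - \<epsilon> *\<^sub>R 1)"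
    using csos_interval_certificate[OF assms(2) poly'' slack4] by blast
  \<comment> \<open>Any common upper bound of the four thresholds will do.\<close>
  define r where "r = r1 + r2 + r3 + r4"
  obtain \<psi>1 where \<psi>1: "degree_vec \<psi>1 = 2 * r" "csos (poly_vec \<psi>1)"
      "csos (\<lambda>\<tau>. ?v1 ?Z' ?Z \<tau> - (\<tau> * (Tmax - \<tau>)) *\<^sub>R poly_vec \<psi>1 \<tau> - \<epsilon> *\<^sub>R 1)"
    using r1[of r] by (auto simp: r_def)
  obtain \<psi>2 where \<psi>2: "degree_vec \<psi>2 = 2 * r" "csos (poly_vec \<psi>2)"
      "csos (\<lambda>\<theta>. ?v2 ?Z \<theta> - ((\<theta> - Tmin) * (Tmax - \<theta>)) *\<^sub>R poly_vec \<psi>2 \<theta> - \<epsilon> *\<^sub>R 1)"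
    using r2[of r] by (auto simp: r_def)
  obtain \<psi>3 where \<psi>3: "degree_vec \<psi>3 = 2 * r" "csos (poly_vec \<psi>3)"
      "csos (\<lambda>\<tau>. ?v3 ?Z \<tau> - (\<tau> * (Tmax - \<tau>)) *\<^sub>R poly_vec \<psi>3 \<tau> - \<epsilon> *\<^sub>R 1)"
    using r3[of r] by (auto simp: r_def)
  obtain \<psi>4 where \<psi>4: "degree_vec \<psi>4 = 2 * r" "csos (poly_vec \<psi>4)"
      "csos (\<lambda>\<theta>. ?v4 ?Z \<theta> - ((\<theta> - Tmin) * (Tmax - \<theta>)) *\<^sub>R poly_vec \<psi>4 \<theta> - \<epsilon> *\<^sub>R 1)"
    using r4[of r] by (auto simp: r_def)
  have "\<epsilon> \<le> \<zeta> 0 $ i" for i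
    using \<epsilon>(1,2) \<epsilon>0[of i] by linarith
  then have zero': "0 \<le> \<zeta> 0 - \<epsilon> *\<^sub>R 1"
    by (simp add: less_eq_vec_def)
  have "0 \<le> \<gamma>" by (simp add: \<gamma>_def)
  show ?SOS
    by (rule exI[of _ "degree_vec Z"], rule exI[of _ r], rule exI[of _ Z], rule exI[of _ \<psi>1],
        rule exI[of _ \<psi>2], rule exI[of _ \<psi>3], rule exI[of _ \<psi>4], rule exI[of _ \<gamma>],
        rule exI[of _ \<epsilon>], unfold Z0)
      (intro conjI refl disjI1 zero' \<psi>1 \<psi>2 \<psi>3 \<psi>4 \<open>0 \<le> \<gamma>\<close> \<open>0 < \<epsilon>\<close>)
qed

end
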